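(* If $G$ is a simple mixed graph, then $$\min\{\delta_1(G),\delta_2(G)\}\le\tfrac12\left(\delta_1(G)+\delta_2(G)\right)\le\boldsymbol{\lambda}_1(G)\le\max\{\Delta_1(G),\Delta_2(G)\},$$ where $\boldsymbol{\lambda}_1(G)$ is the largest eigenvalue of $\mathcal{I}(G)$, $\Delta_1(G)=\max_{u\in V_G}(d(u)+d^+(u))$, $\Delta_2(G)=\max_{u\in V_G}(d(u)+d^-(u))$, $\delta_1(G)=\min_{u\in V_G}(d(u)+d^+(u))$ and $\delta_2(G)=\min_{u\in V_G}(d(u)+d^-(u))$.
   Context: A mixed graph $G$ has a finite nonempty vertex set $V_G=\{v_1,\dots,v_n\}$, a finite set $E_G$ of (undirected) edges, each joining an unordered pair of vertices $\{u,v\}$ (a loop if $u=v$), and a finite set $\vec E_G$ of arcs, each going from $u$ to $v$ for an ordered pair $(u,v)$ of vertices (a directed loop if $u=v$); multiple edges, loops, arcs and directed loops are allowed. $G$ is simple if it has no loops, no directed loops, at most one edge joining any two vertices, and at most one arc from $u$ to $v$ for each ordered pair $(u,v)$ (an edge and arcs in both directions may coexist on the same pair of vertices). The integrated adjacency matrix $\mathcal{I}(G)$ is the real symmetric $2n\times 2n$ matrix $\begin{bmatrix}A&D\\ D^T&A\end{bmatrix}$, where $A_{ij}$ ($i\neq j$) is the number of edges joining $v_i$ and $v_j$, $A_{ii}$ is twice the number of loops at $v_i$, and $D_{ij}$ is the number of arcs from $v_i$ to $v_j$. Degrees: $d(u)$ is the number of edges incident with $u$ (loops counted twice), $d^+(u)$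 the number of arcs starting at $u$, $d^-(u)$ the number of arcs ending at $u$. *)

theory Defs
  imports "Jordan_Normal_Form.Char_Poly"
begin

text \<open>Edges and arcs are abstract objects carrying their incidences, so that parallel ones are
  allowed. An edge is incident with the set of its endpoints, which is a singleton for a loop.\<close>

record ('v, 'e, 'a) mgraph =
  verts :: "'v set"
  edges :: "'e set"
  ends :: "'e \<Rightarrow> 'v set"
  arcs :: "'a set"
  tail :: "'a \<Rightarrow> 'v"
  head :: "'a \<Rightarrow> 'v"

locale mixed_graph =
  fixes G :: "('v, 'e, 'a) mgraph"
  assumes finite_verts: "finite (verts G)"
    and verts_nonempty: "verts G \<noteq> {}"
    and finite_edges: "finite (edges G)"
    and ends_in_verts: "e \<in> edges G \<Longrightarrow> \<exists>u\<in>verts G. \<exists>v\<in>verts G. ends G e = {u, v}"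
    and finite_arcs: "finite (arcs G)"
    and tail_in_verts: "a \<in> arcs G \<Longrightarrow> tail G a \<in> verts G"
    and head_in_verts: "a \<in> arcs G \<Longrightarrow> head G a \<in> verts G"

definition edges_between :: "('v, 'e, 'a) mgraph \<Rightarrow> 'v \<Rightarrow> 'v \<Rightarrow> 'e set" where
  "edges_between G u v = {e \<in> edges G. ends G e = {u, v}}"

definition arcs_from_to :: "('v, 'e, 'a) mgraph \<Rightarrow> 'v \<Rightarrow> 'v \<Rightarrow> 'a set" where
  "arcs_from_to G u v = {a \<in> arcs G. tail G a = u \<and> head G a = v}"

locale simple_mixed_graph = mixed_graph +
  assumes no_loops: "u \<in> verts G \<Longrightarrow> edges_between G u u = {}"
    and no_directed_loops: "u \<in> verts G \<Longrightarrow> arcs_from_to G u u = {}"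
    and no_multiple_edges:
      "\<lbrakk>u \<in> verts G; v \<in> verts G\<rbrakk> \<Longrightarrow> card (edges_between G u v) \<le> 1"
    and no_multiple_arcs:
      "\<lbrakk>u \<in> verts G; v \<in> verts G\<rbrakk> \<Longrightarrow> card (arcs_from_to G u v) \<le> 1"

text \<open>The second summand makes loops count twice.\<close>

definition deg :: "('v, 'e, 'a) mgraph \<Rightarrow> 'v \<Rightarrow> nat" where
  "deg G u = card {e \<in> edges G. u \<in> ends G e} + card (edges_between G u u)"

definition out_deg :: "('v, 'e, 'a) mgraph \<Rightarrow> 'v \<Rightarrow> nat" where
  "out_deg G u = card {a \<in> arcs G. tail G a = u}"

definition in_deg :: "('v, 'e, 'a) mgraph \<Rightarrow> 'v \<Rightarrow> nat" where
  "in_deg G u = card {a \<in> arcs G. head G a = u}"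

definition max_deg_out :: "('v, 'e, 'a) mgraph \<Rightarrow> nat" where
  "max_deg_out G = (MAX u\<in>verts G. deg G u + out_deg G u)"

definition max_deg_in :: "('v, 'e, 'a) mgraph \<Rightarrow> nat" where
  "max_deg_in G = (MAX u\<in>verts G. deg G u + in_deg G u)"

definition min_deg_out :: "('v, 'e, 'a) mgraph \<Rightarrow> nat" where
  "min_deg_out G = (MIN u\<in>verts G. deg G u + out_deg G u)"

definition min_deg_in :: "('v, 'e, 'a) mgraph \<Rightarrow> nat" where
  "min_deg_in G = (MIN u\<in>verts G. deg G u + in_deg G u)"

text \<open>The matrices depend on an enumeration of the vertices, given as a list \<open>vs\<close>; it is meant
  to contain every vertex exactly once.\<close>

definition edge_matrix :: "('v, 'e, 'a) mgraph \<Rightarrow> 'v list \<Rightarrow> real mat" where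
  "edge_matrix G vs = mat (length vs) (length vs) (\<lambda>(i, j).
     if i = j then 2 * real (card (edges_between G (vs ! i) (vs ! i)))
     else real (card (edges_between G (vs ! i) (vs ! j))))"

definition arc_matrix :: "('v, 'e, 'a) mgraph \<Rightarrow> 'v list \<Rightarrow> real mat" where
  "arc_matrix G vs = mat (length vs) (length vs) (\<lambda>(i, j).
     real (card (arcs_from_to G (vs ! i) (vs ! j))))"

definition integrated_adjacency_matrix :: "('v, 'e, 'a) mgraph \<Rightarrow> 'v list \<Rightarrow> real mat" where
  "integrated_adjacency_matrix G vs =
     four_block_mat (edge_matrix G vs) (arc_matrix G vs)
       (transpose_mat (arc_matrix G vs)) (edge_matrix G vs)"

text \<open>Only meaningful when the set of eigenvalues is finite and nonempty, as it is for a real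
  symmetric matrix of positive dimension.\<close>

definition largest_eigenvalue :: "real mat \<Rightarrow> real" where
  "largest_eigenvalue M = Max {k. eigenvalue M k}"

end

theory Submission
  imports Defs "HOL-Analysis.Function_Topology"
begin

text \<open>All row sums of the integrated adjacency matrix are degrees: the row of a vertex \<open>u\<close> in the
  upper half sums to \<open>deg G u + out_deg G u\<close>, the one in the lower half to
  \<open>deg G u + in_deg G u\<close> (lemmas \<open>row_sum_upper\<close>, \<open>row_sum_lower\<close>). The two
  nontrivial inequalities are thus the classical bounds of the largest eigenvalue of a symmetric
  nonnegative matrix by its row sums.

  For the upper bound, compare both sides of the eigenvector equation at a coordinate of largest
  modulus (\<open>eigenvalue_le_row_sum\<close>). For the lower bound, the Rayleigh quotient of the
  all-ones vector is the average row sum. Half of the rows contribute at least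
  \<open>min_deg_out G\<close>, the other half at least \<open>min_deg_in G\<close>, and the largest eigenvalue
  dominates every Rayleigh quotient (\<open>symmetric_kernel_top_eigenvector\<close>).\<close>

section \<open>Rayleigh quotients of a real symmetric kernel\<close>

text \<open>If a nonnegative quadratic form vanishes at \<open>x\<close>, then \<open>x\<close> is a minimum of the form, so the
  derivative there vanishes in every direction. This turns a maximiser of the Rayleigh quotient
  into an eigenvector.\<close>

lemma linear_coefficient_zero:
  fixes b c :: real
  assumes "\<And>t. 0 \<le> 2 * t * b + t\<^sup>2 * c"
  shows "b = 0"
proof (rule ccontr)
  assume "b \<noteq> 0"
  define s where "s = \<bar>c\<bar> + 1"
  have s: "s > 0" "c < 2 * s" by (auto simp: s_def)
  \<comment> \<open>At this \<open>t\<close> the value is \<open>(b / s)\<^sup>2 * (c - 2 * s)\<close>.\<close>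
  have "2 * (- b / s) * b + (- b / s)\<^sup>2 * c = (b / s)\<^sup>2 * (c - 2 * s)"
    using s(1) by (simp add: field_simps power2_eq_square)
  also have "\<dots> < 0"
    using s \<open>b \<noteq> 0\<close> by (intro mult_pos_neg) auto
  finally show False using assms[of "- b / s"] by linarith
qed

lemma psd_kernel_null_vector:
  fixes b :: "'i \<Rightarrow> 'i \<Rightarrow> real"
  assumes fin: "finite I"
    and sym: "\<And>i j. i \<in> I \<Longrightarrow> j \<in> I \<Longrightarrow> b i j = b j i"
    and psd: "\<And>y. 0 \<le> (\<Sum>i\<in>I. \<Sum>j\<in>I. y i * b i j * y j)"
    and zero: "(\<Sum>i\<in>I. \<Sum>j\<in>I. x i * b i j * x j) = 0"
    and i: "i \<in> I"
  shows "(\<Sum>j\<in>I. b i j * x j) = 0"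
proof (rule linear_coefficient_zero)
  fix t :: real
  define e :: "'i \<Rightarrow> real" where "e k = (if k = i then 1 else 0)" for k
  have xe: "(\<Sum>k\<in>I. \<Sum>j\<in>I. x k * b k j * e j) = (\<Sum>j\<in>I. b i j * x j)"
    using fin i by (auto simp: e_def sum.delta if_distrib cong: if_cong intro!: sum.cong sym)
  have "(\<Sum>k\<in>I. \<Sum>j\<in>I. e k * b k j * x j) = (\<Sum>k\<in>I. if k = i then \<Sum>j\<in>I. b k j * x j else 0)"
    by (intro sum.cong) (auto simp: e_def)
  then have ex: "(\<Sum>k\<in>I. \<Sum>j\<in>I. e k * b k j * x j) = (\<Sum>j\<in>I. b i j * x j)"
    using fin i by simp
  have "0 \<le> (\<Sum>k\<in>I. \<Sum>j\<in>I. (x k + t * e k) * b k j * (x j + t * e j))"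
    by (rule psd)
  also have "\<dots> = (\<Sum>k\<in>I. \<Sum>j\<in>I. x k * b k j * x j)
      + t * (\<Sum>k\<in>I. \<Sum>j\<in>I. x k * b k j * e j) + t * (\<Sum>k\<in>I. \<Sum>j\<in>I. e k * b k j * x j)
      + t\<^sup>2 * (\<Sum>k\<in>I. \<Sum>j\<in>I. e k * b k j * e j)"
    by (simp add: sum_distrib_left sum.distrib [symmetric] algebra_simps power2_eq_square)
  finally show "0 \<le> 2 * t * (\<Sum>j\<in>I. b i j * x j)
      + t\<^sup>2 * (\<Sum>k\<in>I. \<Sum>j\<in>I. e k * b k j * e j)"
    by (simp add: xe ex zero)
qed

text \<open>The unit sphere is cut out of a product of compact intervals. Coordinates outside \<open>I\<close> are
  pinned to \<open>0\<close>: otherwise they would be unconstrained and the sphere would not be compact.\<close>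

lemma compact_finite_sphere:
  fixes I :: "'i set"
  assumes fin: "finite I"
  shows "compact {x :: 'i \<Rightarrow> real. (\<forall>i. i \<notin> I \<longrightarrow> x i = 0) \<and> (\<Sum>i\<in>I. (x i)\<^sup>2) = 1}"
proof -
  define K :: "('i \<Rightarrow> real) set" where
    "K = Pi\<^sub>E UNIV (\<lambda>i. if i \<in> I then {-1..1} else {0})"
  have "compactin (product_topology (\<lambda>i. euclidean) UNIV) K"
    unfolding K_def by (subst compactin_PiE) auto
  then have "compact K"
    by (simp add: euclidean_product_topology)
  moreover have "closed {x :: 'i \<Rightarrow> real. (\<Sum>i\<in>I. (x i)\<^sup>2) = 1}"
    by (intro closed_Collect_eq continuous_intros continuous_on_product_coordinates)
  ultimately have "compact (K \<inter> {x. (\<Sum>i\<in>I. (x i)\<^sup>2) = 1})"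
    by (rule compact_Int_closed)
  moreover have "K \<inter> {x. (\<Sum>i\<in>I. (x i)\<^sup>2) = 1}
      = {x. (\<forall>i. i \<notin> I \<longrightarrow> x i = 0) \<and> (\<Sum>i\<in>I. (x i)\<^sup>2) = 1}"
  proof -
    have "\<bar>x i\<bar> \<le> 1" if "(\<Sum>i\<in>I. (x i)\<^sup>2) = 1" "i \<in> I" for x :: "'i \<Rightarrow> real" and i
      using member_le_sum[of i I "\<lambda>i. (x i)\<^sup>2"] that fin by (simp add: abs_square_le_1)
    then show ?thesis
      by (fastforce simp: K_def PiE_iff abs_le_iff split: if_splits)
  qed
  ultimately show ?thesis by simp
qed

text \<open>The Rayleigh quotient attains its maximum \<open>\<mu>\<close> on the compact unit sphere. Then
  \<open>\<mu> I - a\<close> is positive semidefinite, and its form vanishes at the maximiser, which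
  therefore is an eigenvector for \<open>\<mu>\<close>.\<close>

lemma symmetric_kernel_top_eigenvector:
  fixes a :: "'i \<Rightarrow> 'i \<Rightarrow> real"
  assumes fin: "finite I" and ne: "I \<noteq> {}"
    and sym: "\<And>i j. i \<in> I \<Longrightarrow> j \<in> I \<Longrightarrow> a i j = a j i"
  obtains \<mu> x where "\<exists>i\<in>I. x i \<noteq> 0"
    and "\<And>i. i \<in> I \<Longrightarrow> (\<Sum>j\<in>I. a i j * x j) = \<mu> * x i"
    and "\<And>y. (\<Sum>i\<in>I. \<Sum>j\<in>I. y i * a i j * y j) \<le> \<mu> * (\<Sum>i\<in>I. (y i)\<^sup>2)"
proof -
  define S :: "('i \<Rightarrow> real) set" where
    "S = {x. (\<forall>i. i \<notin> I \<longrightarrow> x i = 0) \<and> (\<Sum>i\<in>I. (x i)\<^sup>2) = 1}"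
  define q where "q y = (\<Sum>i\<in>I. \<Sum>j\<in>I. y i * a i j * y j)" for y
  have "compact S"
    unfolding S_def by (rule compact_finite_sphere[OF fin])
  moreover have "S \<noteq> {}"
  proof -
    obtain k where k: "k \<in> I" using ne by auto
    have "(\<lambda>i. if i = k then 1 else 0) \<in> S"
      using k fin by (auto simp: S_def if_distrib[of "\<lambda>z. z\<^sup>2"] cong: if_cong)
    then show ?thesis by auto
  qed
  moreover have "continuous_on S q"
    unfolding q_def
    by (intro continuous_intros continuous_on_subset[OF continuous_on_product_coordinates]) auto
  ultimately obtain x where x: "x \<in> S" and max: "\<And>y. y \<in> S \<Longrightarrow> q y \<le> q x"
    using continuous_attains_sup by metis
  define \<mu> where "\<mu> = q x"
  have le: "q y \<le> \<mu> * (\<Sum>i\<in>I. (y i)\<^sup>2)" for y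
  proof (cases "(\<Sum>i\<in>I. (y i)\<^sup>2) = 0")
    case True
    then have "y i = 0" if "i \<in> I" for i
      using that fin by (simp add: sum_nonneg_eq_0_iff)
    then show ?thesis by (simp add: q_def)
  next
    case False
    define r where "r = sqrt (\<Sum>i\<in>I. (y i)\<^sup>2)"
    have nn: "(\<Sum>i\<in>I. (y i)\<^sup>2) \<ge> 0" by (simp add: sum_nonneg)
    have r: "r > 0" "r\<^sup>2 = (\<Sum>i\<in>I. (y i)\<^sup>2)"
      using False nn by (simp_all add: r_def less_le)
    define z where "z i = (if i \<in> I then y i / r else 0)" for i
    have "(\<Sum>i\<in>I. (z i)\<^sup>2) = (\<Sum>i\<in>I. (y i)\<^sup>2 / r\<^sup>2)"
      by (simp add: z_def power_divide)
    also have "\<dots> = 1"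
      using r False by (simp flip: sum_divide_distrib)
    finally have "z \<in> S" by (simp add: S_def z_def)
    then have "q z \<le> \<mu>" unfolding \<mu>_def by (rule max)
    moreover have "q z = q y / r\<^sup>2"
      by (simp add: q_def z_def sum_divide_distrib power2_eq_square)
    ultimately have "q y / r\<^sup>2 \<le> \<mu>" by simp
    then have "q y \<le> \<mu> * r\<^sup>2"
      using r(1) by (simp add: pos_divide_le_eq)
    then show ?thesis unfolding r(2) .
  qed
  define b where "b i j = (if i = j then \<mu> else 0) - a i j" for i j
  have row: "(\<Sum>j\<in>I. b i j * y j) = \<mu> * y i - (\<Sum>j\<in>I. a i j * y j)" if "i \<in> I" for i y
  proof -
    have "(\<Sum>j\<in>I. b i j * y j) = (\<Sum>j\<in>I. (if i = j then \<mu> * y j else 0) - a i j * y j)"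
      by (intro sum.cong) (auto simp: b_def algebra_simps)
    then show ?thesis using that fin by (simp add: sum_subtractf)
  qed
  have form: "(\<Sum>i\<in>I. \<Sum>j\<in>I. y i * b i j * y j) = \<mu> * (\<Sum>i\<in>I. (y i)\<^sup>2) - q y" for y
  proof -
    have "(\<Sum>i\<in>I. \<Sum>j\<in>I. y i * b i j * y j) = (\<Sum>i\<in>I. y i * (\<Sum>j\<in>I. b i j * y j))"
      by (simp add: sum_distrib_left mult.assoc)
    also have "\<dots> = (\<Sum>i\<in>I. \<mu> * (y i)\<^sup>2 - (\<Sum>j\<in>I. y i * a i j * y j))"
    proof (rule sum.cong[OF refl])
      fix i assume "i \<in> I"
      then show "y i * (\<Sum>j\<in>I. b i j * y j) = \<mu> * (y i)\<^sup>2 - (\<Sum>j\<in>I. y i * a i j * y j)"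
        unfolding row[OF \<open>i \<in> I\<close>]
        by (simp add: right_diff_distrib sum_distrib_left mult_ac power2_eq_square)
    qed
    also have "\<dots> = \<mu> * (\<Sum>i\<in>I. (y i)\<^sup>2) - q y"
      by (simp add: sum_subtractf sum_distrib_left q_def)
    finally show ?thesis .
  qed
  have "(\<Sum>j\<in>I. b i j * x j) = 0" if "i \<in> I" for i
  proof (rule psd_kernel_null_vector[OF fin])
    show "b i j = b j i" if "i \<in> I" "j \<in> I" for i j
      using sym[OF that] by (simp add: b_def)
    show "0 \<le> (\<Sum>i\<in>I. \<Sum>j\<in>I. y i * b i j * y j)" for y
      using le[of y] by (simp add: form)
    show "(\<Sum>i\<in>I. \<Sum>j\<in>I. x i * b i j * x j) = 0"
      using x unfolding form by (simp add: \<mu>_def S_def)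
  qed (fact that)
  then have "(\<Sum>j\<in>I. a i j * x j) = \<mu> * x i" if "i \<in> I" for i
    using that row[of i x] by simp
  moreover have "\<exists>i\<in>I. x i \<noteq> 0"
  proof (rule ccontr)
    assume "\<not> (\<exists>i\<in>I. x i \<noteq> 0)"
    then have "(\<Sum>i\<in>I. (x i)\<^sup>2) = 0" by simp
    then show False using x by (simp add: S_def)
  qed
  ultimately show thesis
    using that le unfolding q_def by blast
qed

section \<open>Eigenvalues of matrices\<close>

lemma finite_eigenvalues:
  fixes A :: "'a :: field mat"
  assumes A: "A \<in> carrier_mat n n"
  shows "finite {k. eigenvalue A k}"
proof -
  have "char_poly A \<noteq> 0"
    using degree_monic_char_poly[OF A] by auto
  then show ?thesis
    using poly_roots_finite by (simp add: eigenvalue_root_char_poly[OF A])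
qed

lemma index_mult_mat_vec_sum:
  assumes "A \<in> carrier_mat n n" "v \<in> carrier_vec n" "i < n"
  shows "vec_index (A *\<^sub>v v) i = (\<Sum>j<n. A $$ (i, j) * vec_index v j)"
  using assms by (auto simp: scalar_prod_def lessThan_atLeast0 intro!: sum.cong)

lemma symmetric_mat_eigenvalue_ge_rayleigh:
  fixes A :: "real mat"
  assumes A: "A \<in> carrier_mat n n" and n: "n > 0"
    and sym: "\<And>i j. i < n \<Longrightarrow> j < n \<Longrightarrow> A $$ (i, j) = A $$ (j, i)"
  obtains \<mu> where "eigenvalue A \<mu>"
    and "\<And>y. (\<Sum>i<n. \<Sum>j<n. y i * A $$ (i, j) * y j) \<le> \<mu> * (\<Sum>i<n. (y i)\<^sup>2)"
proof -
  obtain \<mu> x where nz: "\<exists>i\<in>{..<n}. x i \<noteq> 0"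
    and eq: "\<And>i. i \<in> {..<n} \<Longrightarrow> (\<Sum>j<n. A $$ (i, j) * x j) = \<mu> * x i"
    and le: "\<And>y. (\<Sum>i<n. \<Sum>j<n. y i * A $$ (i, j) * y j) \<le> \<mu> * (\<Sum>i<n. (y i)\<^sup>2)"
    by (rule symmetric_kernel_top_eigenvector[of "{..<n}" "\<lambda>i j. A $$ (i, j)"])
      (use n sym in auto)
  have "A *\<^sub>v vec n x = \<mu> \<cdot>\<^sub>v vec n x"
  proof (rule eq_vecI)
    fix i assume "i < dim_vec (\<mu> \<cdot>\<^sub>v vec n x)"
    then have i: "i < n" by simp
    have "vec_index (A *\<^sub>v vec n x) i = (\<Sum>j<n. A $$ (i, j) * x j)"
      using index_mult_mat_vec_sum[OF A _ i, of "vec n x"] by simp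
    then show "vec_index (A *\<^sub>v vec n x) i = vec_index (\<mu> \<cdot>\<^sub>v vec n x) i"
      using eq i by simp
  qed (use A in simp)
  moreover have "vec n x \<noteq> 0\<^sub>v n"
  proof
    assume "vec n x = 0\<^sub>v n"
    then have "x i = 0" if "i < n" for i
      using that by (metis index_vec index_zero_vec(1))
    with nz show False by auto
  qed
  ultimately have "eigenvalue A \<mu>"
    unfolding eigenvalue_def eigenvector_def using A by (intro exI[of _ "vec n x"]) auto
  then show thesis using le by (rule that)
qed

text \<open>At a coordinate \<open>i\<close> where the eigenvector \<open>v\<close> is largest in modulus, the eigenvector equation
  reads \<open>k * v i = \<Sum>j. A i j * v j\<close>, and every \<open>\<bar>v j\<bar>\<close> is at most \<open>\<bar>v i\<bar> \<noteq> 0\<close>.\<close>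

lemma eigenvalue_le_row_sum:
  fixes A :: "real mat"
  assumes A: "A \<in> carrier_mat n n" and ev: "eigenvalue A k"
    and row: "\<And>i. i < n \<Longrightarrow> (\<Sum>j<n. \<bar>A $$ (i, j)\<bar>) \<le> r"
  shows "\<bar>k\<bar> \<le> r"
proof -
  obtain v where v: "v \<in> carrier_vec n" "v \<noteq> 0\<^sub>v n" "A *\<^sub>v v = k \<cdot>\<^sub>v v"
    using ev A unfolding eigenvalue_def eigenvector_def by auto
  define f where "f i = \<bar>vec_index v i\<bar>" for i
  obtain i0 where i0: "i0 < n" "vec_index v i0 \<noteq> 0"
    using v(1,2) by (metis carrier_vecD eq_vecI index_zero_vec)
  have "Max (f ` {..<n}) \<in> f ` {..<n}"
    using i0(1) by (intro Max_in) auto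
  then obtain i where i: "i < n" and fi: "f i = Max (f ` {..<n})"
    by auto
  have max: "f j \<le> f i" if "j < n" for j
    unfolding fi using that by (intro Max_ge) auto
  have pos: "f i > 0" using max[OF i0(1)] i0(2) by (simp add: f_def)
  have "\<bar>k\<bar> * f i = \<bar>vec_index (A *\<^sub>v v) i\<bar>"
    using v i by (simp add: f_def abs_mult)
  also have "\<dots> = \<bar>\<Sum>j<n. A $$ (i, j) * vec_index v j\<bar>"
    using index_mult_mat_vec_sum[OF A v(1) i] by simp
  also have "\<dots> \<le> (\<Sum>j<n. \<bar>A $$ (i, j)\<bar> * f j)"
    using sum_abs[of "\<lambda>j. A $$ (i, j) * vec_index v j" "{..<n}"] by (simp add: f_def abs_mult)
  also have "\<dots> \<le> (\<Sum>j<n. \<bar>A $$ (i, j)\<bar> * f i)"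
    by (intro sum_mono mult_left_mono) (auto simp: max)
  also have "\<dots> = (\<Sum>j<n. \<bar>A $$ (i, j)\<bar>) * f i"
    by (simp add: sum_distrib_right)
  also have "\<dots> \<le> r * f i"
    using row[OF i] pos by (intro mult_right_mono) auto
  finally show ?thesis using pos by simp
qed

section \<open>Row sums of the integrated adjacency matrix\<close>

lemma edges_between_commute: "edges_between G u v = edges_between G v u"
  by (simp add: edges_between_def insert_commute)

text \<open>Every edge at \<open>u\<close> has exactly one other endpoint \<open>v\<close>, where a loop counts as having
  the other endpoint \<open>u\<close>.\<close>

lemma (in mixed_graph) deg_eq_sum_edges_between:
  assumes u: "u \<in> verts G"
  shows "deg G u = (\<Sum>v\<in>verts G. card (edges_between G u v)) + card (edges_between G u u)"
proof -
  have "{e \<in> edges G. u \<in> ends G e} = (\<Union>v\<in>verts G. edges_between G u v)"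
    using ends_in_verts by (fastforce simp: edges_between_def)
  moreover have "card (\<Union>v\<in>verts G. edges_between G u v)
      = (\<Sum>v\<in>verts G. card (edges_between G u v))"
    using finite_verts finite_edges
    by (intro card_UN_disjoint) (auto simp: edges_between_def doubleton_eq_iff)
  ultimately show ?thesis by (simp add: deg_def)
qed

lemma (in mixed_graph) out_deg_eq_sum_arcs:
  "out_deg G u = (\<Sum>v\<in>verts G. card (arcs_from_to G u v))"
proof -
  have "{a \<in> arcs G. tail G a = u} = (\<Union>v\<in>verts G. arcs_from_to G u v)"
    using head_in_verts by (auto simp: arcs_from_to_def)
  moreover have "card (\<Union>v\<in>verts G. arcs_from_to G u v)
      = (\<Sum>v\<in>verts G. card (arcs_from_to G u v))"
    using finite_verts finite_arcs
    by (intro card_UN_disjoint) (auto simp: arcs_from_to_def)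
  ultimately show ?thesis by (simp add: out_deg_def)
qed

lemma (in mixed_graph) in_deg_eq_sum_arcs:
  "in_deg G v = (\<Sum>u\<in>verts G. card (arcs_from_to G u v))"
proof -
  have "{a \<in> arcs G. head G a = v} = (\<Union>u\<in>verts G. arcs_from_to G u v)"
    using tail_in_verts by (auto simp: arcs_from_to_def)
  moreover have "card (\<Union>u\<in>verts G. arcs_from_to G u v)
      = (\<Sum>u\<in>verts G. card (arcs_from_to G u v))"
    using finite_verts finite_arcs
    by (intro card_UN_disjoint) (auto simp: arcs_from_to_def)
  ultimately show ?thesis by (simp add: in_deg_def)
qed

lemma integrated_adjacency_matrix_carrier:
  "integrated_adjacency_matrix G vs \<in> carrier_mat (length vs + length vs) (length vs + length vs)"
  by (auto simp: integrated_adjacency_matrix_def edge_matrix_def arc_matrix_def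
      intro!: four_block_carrier_mat)

lemma integrated_adjacency_matrix_index:
  assumes "i < length vs + length vs" "j < length vs + length vs"
  shows "integrated_adjacency_matrix G vs $$ (i, j) =
    (let n = length vs in
      if i < n then (if j < n then edge_matrix G vs $$ (i, j) else arc_matrix G vs $$ (i, j - n))
      else (if j < n then arc_matrix G vs $$ (j, i - n) else edge_matrix G vs $$ (i - n, j - n)))"
  using assms
  by (auto simp: integrated_adjacency_matrix_def edge_matrix_def arc_matrix_def Let_def)

lemma integrated_adjacency_matrix_sym:
  assumes "i < length vs + length vs" "j < length vs + length vs"
  shows "integrated_adjacency_matrix G vs $$ (i, j) = integrated_adjacency_matrix G vs $$ (j, i)"
  using assms
  by (auto simp: integrated_adjacency_matrix_index Let_def edge_matrix_def edges_between_commute)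

lemma integrated_adjacency_matrix_nonneg:
  assumes "i < length vs + length vs" "j < length vs + length vs"
  shows "integrated_adjacency_matrix G vs $$ (i, j) \<ge> 0"
  using assms
  by (auto simp: integrated_adjacency_matrix_index Let_def edge_matrix_def arc_matrix_def)

lemma sum_lessThan_add:
  fixes f :: "nat \<Rightarrow> 'a :: comm_monoid_add"
  shows "(\<Sum>j<m + n. f j) = (\<Sum>j<m. f j) + (\<Sum>j<n. f (m + j))"
  by (induction n) (simp_all add: add.assoc)

lemma sum_nth_distinct:
  assumes "distinct vs"
  shows "(\<Sum>j<length vs. f (vs ! j)) = (\<Sum>v\<in>set vs. f v)"
  using sum.reindex_bij_betw[OF bij_betw_nth[OF assms refl refl]] .

lemma (in mixed_graph) edge_matrix_row_sum:
  assumes vs: "distinct vs" "set vs = verts G" and i: "i < length vs"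
  shows "(\<Sum>j<length vs. edge_matrix G vs $$ (i, j)) = real (deg G (vs ! i))"
proof -
  let ?e = "\<lambda>v. card (edges_between G (vs ! i) v)"
  \<comment> \<open>The doubled diagonal entry matches the second summand of \<open>deg\<close>.\<close>
  have "(\<Sum>j<length vs. edge_matrix G vs $$ (i, j))
      = (\<Sum>j<length vs. real (?e (vs ! j)) + (if i = j then real (?e (vs ! i)) else 0))"
    using i by (intro sum.cong) (auto simp: edge_matrix_def)
  also have "\<dots> = (\<Sum>j<length vs. real (?e (vs ! j))) + real (?e (vs ! i))"
    using i by (simp add: sum.distrib)
  also have "(\<Sum>j<length vs. real (?e (vs ! j))) = (\<Sum>v\<in>verts G. real (?e v))"
    using sum_nth_distinct[OF vs(1), of "\<lambda>v. real (?e v)"] vs(2) by simp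
  finally show ?thesis
    using deg_eq_sum_edges_between[of "vs ! i"] nth_mem[OF i] vs(2) by simp
qed

lemma (in mixed_graph) row_sum_upper:
  assumes vs: "distinct vs" "set vs = verts G" and i: "i < length vs"
  shows "(\<Sum>j<length vs + length vs. integrated_adjacency_matrix G vs $$ (i, j))
    = real (deg G (vs ! i) + out_deg G (vs ! i))"
proof -
  let ?n = "length vs"
  have "(\<Sum>j<?n. arc_matrix G vs $$ (i, j))
      = (\<Sum>j<?n. real (card (arcs_from_to G (vs ! i) (vs ! j))))"
    using i by (simp add: arc_matrix_def)
  also have "\<dots> = real (out_deg G (vs ! i))"
    using sum_nth_distinct[OF vs(1), of "\<lambda>v. real (card (arcs_from_to G (vs ! i) v))"] vs(2)
    by (simp add: out_deg_eq_sum_arcs)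
  finally show ?thesis
    using i edge_matrix_row_sum[OF vs i]
    by (simp add: sum_lessThan_add integrated_adjacency_matrix_index)
qed

lemma (in mixed_graph) row_sum_lower:
  assumes vs: "distinct vs" "set vs = verts G" and i: "i < length vs"
  shows "(\<Sum>j<length vs + length vs. integrated_adjacency_matrix G vs $$ (length vs + i, j))
    = real (deg G (vs ! i) + in_deg G (vs ! i))"
proof -
  let ?n = "length vs"
  have "(\<Sum>j<?n. arc_matrix G vs $$ (j, i))
      = (\<Sum>j<?n. real (card (arcs_from_to G (vs ! j) (vs ! i))))"
    using i by (simp add: arc_matrix_def)
  also have "\<dots> = real (in_deg G (vs ! i))"
    using sum_nth_distinct[OF vs(1), of "\<lambda>v. real (card (arcs_from_to G v (vs ! i)))"] vs(2)
    by (simp add: in_deg_eq_sum_arcs)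
  finally show ?thesis
    using i edge_matrix_row_sum[OF vs i]
    by (simp add: sum_lessThan_add integrated_adjacency_matrix_index)
qed

section \<open>Bounds of the largest eigenvalue by degrees\<close>

lemma (in mixed_graph) average_min_deg_le_largest_eigenvalue:
  assumes vs: "distinct vs" "set vs = verts G"
  shows "(real (min_deg_out G) + real (min_deg_in G)) / 2
    \<le> largest_eigenvalue (integrated_adjacency_matrix G vs)"
proof -
  define n where "n = length vs"
  define M where "M = integrated_adjacency_matrix G vs"
  have M: "M \<in> carrier_mat (n + n) (n + n)"
    unfolding M_def n_def by (rule integrated_adjacency_matrix_carrier)
  have n: "n > 0" using verts_nonempty vs(2) by (auto simp: n_def)
  obtain \<mu> where ev: "eigenvalue M \<mu>"
    and le: "\<And>y. (\<Sum>i<n + n. \<Sum>j<n + n. y i * M $$ (i, j) * y j) \<le> \<mu> * (\<Sum>i<n + n. (y i)\<^sup>2)"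
    by (rule symmetric_mat_eigenvalue_ge_rayleigh[OF M])
      (use n in \<open>auto simp: M_def n_def intro: integrated_adjacency_matrix_sym\<close>)
  have out: "min_deg_out G \<le> deg G (vs ! i) + out_deg G (vs ! i)" if "i < n" for i
    unfolding min_deg_out_def using that finite_verts vs(2) by (auto simp: n_def intro!: Min_le)
  have "in": "min_deg_in G \<le> deg G (vs ! i) + in_deg G (vs ! i)" if "i < n" for i
    unfolding min_deg_in_def using that finite_verts vs(2) by (auto simp: n_def intro!: Min_le)
  have "real n * (real (min_deg_out G) + real (min_deg_in G))
      = (\<Sum>i<n. real (min_deg_out G)) + (\<Sum>i<n. real (min_deg_in G))"
    by (simp add: algebra_simps)
  also have "\<dots> \<le> (\<Sum>i<n. real (deg G (vs ! i) + out_deg G (vs ! i)))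
      + (\<Sum>i<n. real (deg G (vs ! i) + in_deg G (vs ! i)))"
    by (intro add_mono sum_mono of_nat_mono) (use out "in" in auto)
  also have "\<dots> = (\<Sum>i<n. \<Sum>j<n + n. M $$ (i, j)) + (\<Sum>i<n. \<Sum>j<n + n. M $$ (n + i, j))"
    unfolding M_def n_def by (simp add: row_sum_upper[OF vs] row_sum_lower[OF vs])
  also have "\<dots> = (\<Sum>i<n + n. \<Sum>j<n + n. M $$ (i, j))"
    by (rule sum_lessThan_add[symmetric])
  also have "\<dots> \<le> \<mu> * (2 * real n)"
    using le[of "\<lambda>_. 1"] by simp
  finally have "real n * (real (min_deg_out G) + real (min_deg_in G)) \<le> real n * (2 * \<mu>)"
    by (simp add: mult_ac)
  then have "(real (min_deg_out G) + real (min_deg_in G)) / 2 \<le> \<mu>"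
    using n by (simp only: mult_le_cancel_left_pos of_nat_0_less_iff) simp
  also have "\<mu> \<le> largest_eigenvalue M"
    unfolding largest_eigenvalue_def using ev finite_eigenvalues[OF M] by (intro Max_ge) auto
  finally show ?thesis by (simp add: M_def)
qed

lemma (in mixed_graph) largest_eigenvalue_le_max_deg:
  assumes vs: "distinct vs" "set vs = verts G"
  shows "largest_eigenvalue (integrated_adjacency_matrix G vs)
    \<le> real (max (max_deg_out G) (max_deg_in G))"
proof -
  define n where "n = length vs"
  define M where "M = integrated_adjacency_matrix G vs"
  have M: "M \<in> carrier_mat (n + n) (n + n)"
    unfolding M_def n_def by (rule integrated_adjacency_matrix_carrier)
  have n: "n > 0" using verts_nonempty vs(2) by (auto simp: n_def)
  have out: "deg G (vs ! i) + out_deg G (vs ! i) \<le> max_deg_out G" if "i < n" for i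
    unfolding max_deg_out_def using that finite_verts vs(2) by (auto simp: n_def intro!: Max_ge)
  have "in": "deg G (vs ! i) + in_deg G (vs ! i) \<le> max_deg_in G" if "i < n" for i
    unfolding max_deg_in_def using that finite_verts vs(2) by (auto simp: n_def intro!: Max_ge)
  have row: "(\<Sum>j<n + n. \<bar>M $$ (i, j)\<bar>) \<le> real (max (max_deg_out G) (max_deg_in G))"
    if i: "i < n + n" for i
  proof -
    have "(\<Sum>j<n + n. \<bar>M $$ (i, j)\<bar>) = (\<Sum>j<n + n. M $$ (i, j))"
      using i by (intro sum.cong) (auto simp: M_def n_def integrated_adjacency_matrix_nonneg)
    also have "\<dots> \<le> real (max (max_deg_out G) (max_deg_in G))"
    proof (cases "i < n")
      case True
      then have "(\<Sum>j<n + n. M $$ (i, j)) = real (deg G (vs ! i) + out_deg G (vs ! i))"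
        unfolding M_def n_def by (rule row_sum_upper[OF vs])
      also have "\<dots> \<le> real (max (max_deg_out G) (max_deg_in G))"
        using out[OF True] by (intro of_nat_mono) simp
      finally show ?thesis .
    next
      case False
      then obtain k where k: "i = n + k" "k < n"
        using i by (metis add_less_cancel_left le_Suc_ex not_less)
      then have "(\<Sum>j<n + n. M $$ (i, j)) = real (deg G (vs ! k) + in_deg G (vs ! k))"
        unfolding M_def n_def by (simp only: row_sum_lower[OF vs])
      also have "\<dots> \<le> real (max (max_deg_out G) (max_deg_in G))"
        using "in"[OF k(2)] by (intro of_nat_mono) simp
      finally show ?thesis .
    qed
    finally show ?thesis .
  qed
  \<comment> \<open>\<open>Max\<close> over the spectrum says something only once the spectrum is known to be nonempty.\<close>
  obtain \<mu> where "eigenvalue M \<mu>"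
    by (rule symmetric_mat_eigenvalue_ge_rayleigh[OF M])
      (use n in \<open>auto simp: M_def n_def intro: integrated_adjacency_matrix_sym\<close>)
  then have "eigenvalue M (largest_eigenvalue M)"
    unfolding largest_eigenvalue_def using Max_in[OF finite_eigenvalues[OF M]] by auto
  then have "\<bar>largest_eigenvalue M\<bar> \<le> real (max (max_deg_out G) (max_deg_in G))"
    by (rule eigenvalue_le_row_sum[OF M _ row])
  then show ?thesis by (simp add: M_def)
qed

theorem theorem8p2:
  fixes G :: "('v, 'e, 'a) mgraph" and vs :: "'v list"
  assumes "simple_mixed_graph G"
    and "distinct vs" and "set vs = verts G"
  shows "real (min (min_deg_out G) (min_deg_in G))
           \<le> (1 / 2) * (real (min_deg_out G) + real (min_deg_in G))
       \<and> (1 / 2) * (real (min_deg_out G) + real (min_deg_in G))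
           \<le> largest_eigenvalue (integrated_adjacency_matrix G vs)
       \<and> largest_eigenvalue (integrated_adjacency_matrix G vs)
           \<le> real (max (max_deg_out G) (max_deg_in G))"
proof -
  interpret simple_mixed_graph G by fact
  have "real (min (min_deg_out G) (min_deg_in G))
      \<le> (1 / 2) * (real (min_deg_out G) + real (min_deg_in G))"
    by (simp add: min_def)
  then show ?thesis
    using average_min_deg_le_largest_eigenvalue[OF assms(2,3)]
      largest_eigenvalue_le_max_deg[OF assms(2,3)] by simp
qed

end
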